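(* If $T$ is a tree with simple eigenvalues on at least four vertices and $T$ is not isomorphic to $P_4$, then $\operatorname{rk}(\widehat{M}(T))\geq 3$.
   Context: Graphs are finite, simple and undirected; a tree is a connected graph with no cycles. $P_4$ is the path on four vertices. The eigenvalues of a graph $X$ are those of its adjacency matrix $A=A(X)$. A graph on $n$ vertices has simple eigenvalues if $A$ has $n$ distinct eigenvalues. The transition matrix of the continuous-time quantum walk on $X$ is $U(t)=\exp(itA)$, the mixing matrix is $M(t)=U(t)\circ\overline{U(t)}$, where $\circ$ denotes the entrywise (Schur/Hadamard) product, and the average mixing matrix of $X$ is \[ \widehat{M}=\widehat{M}(X)=\lim_{T\to\infty}\frac1T\int_0^T M(t)\,dt . \] (In this formula $T$ is a real time parameter.) $\operatorname{rk}$ denotes matrix rank. *)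

theory Defs
  imports "HOL-Analysis.Analysis"
begin

text \<open>
  A finite simple graph is given by its adjacency relation, a symmetric and irreflexive relation
  on a finite vertex type; matrices of the graph are then indexed by the vertices.
\<close>

definition simple_graph :: "('v \<Rightarrow> 'v \<Rightarrow> bool) \<Rightarrow> bool" where
  "simple_graph E \<longleftrightarrow> symp E \<and> irreflp E"

definition connected_graph :: "('v \<Rightarrow> 'v \<Rightarrow> bool) \<Rightarrow> bool" where
  "connected_graph E \<longleftrightarrow> (\<forall>u v. E\<^sup>*\<^sup>* u v)"

text \<open>The length bound excludes traversing a single edge back and forth.\<close>

definition graph_cycle :: "('v \<Rightarrow> 'v \<Rightarrow> bool) \<Rightarrow> 'v list \<Rightarrow> bool" where
  "graph_cycle E vs \<longleftrightarrow> length vs \<ge> 3 \<and> distinct vs \<and>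
     (\<forall>i < length vs. E (vs ! i) (vs ! (Suc i mod length vs)))"

definition tree_graph :: "('v \<Rightarrow> 'v \<Rightarrow> bool) \<Rightarrow> bool" where
  "tree_graph E \<longleftrightarrow> simple_graph E \<and> connected_graph E \<and> (\<nexists>vs. graph_cycle E vs)"

definition graph_isomorphic ::
    "'a set \<Rightarrow> ('a \<Rightarrow> 'a \<Rightarrow> bool) \<Rightarrow> 'b set \<Rightarrow> ('b \<Rightarrow> 'b \<Rightarrow> bool) \<Rightarrow> bool" where
  "graph_isomorphic V E W F \<longleftrightarrow>
     (\<exists>f. bij_betw f V W \<and> (\<forall>u\<in>V. \<forall>v\<in>V. E u v \<longleftrightarrow> F (f u) (f v)))"

text \<open>The path on \<open>n\<close> vertices is this adjacency relation on the vertex set \<open>{..<n}\<close>.\<close>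

definition path_adj :: "nat \<Rightarrow> nat \<Rightarrow> bool" where
  "path_adj i j \<longleftrightarrow> j = Suc i \<or> i = Suc j"

definition adjacency_matrix :: "('v::finite \<Rightarrow> 'v \<Rightarrow> bool) \<Rightarrow> complex^'v^'v" where
  "adjacency_matrix E = (\<chi> u v. if E u v then 1 else 0)"

definition eigenvalues :: "complex^'n^'n \<Rightarrow> complex set" where
  "eigenvalues A = {c. \<exists>x. x \<noteq> 0 \<and> A *v x = c *s x}"

definition simple_eigenvalues :: "('v::finite \<Rightarrow> 'v \<Rightarrow> bool) \<Rightarrow> bool" where
  "simple_eigenvalues E \<longleftrightarrow> card (eigenvalues (adjacency_matrix E)) = CARD('v)"

text \<open>
  The library's \<open>(*)\<close> and \<open>(^)\<close> on vectors act componentwise, so powers for the matrix product are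
  written as iterates of \<open>(**)\<close>.
\<close>

definition matrix_exp :: "complex^'n^'n \<Rightarrow> complex^'n^'n" where
  "matrix_exp A = (\<Sum>k. (1 / fact k) *\<^sub>R (((**) A) ^^ k) (mat 1))"

definition transition_matrix :: "('v::finite \<Rightarrow> 'v \<Rightarrow> bool) \<Rightarrow> real \<Rightarrow> complex^'v^'v" where
  "transition_matrix E t =
     matrix_exp (map_matrix (\<lambda>a. \<i> * complex_of_real t * a) (adjacency_matrix E))"

definition mixing_matrix :: "('v::finite \<Rightarrow> 'v \<Rightarrow> bool) \<Rightarrow> real \<Rightarrow> complex^'v^'v" where
  "mixing_matrix E t =
     (\<chi> u v. transition_matrix E t $ u $ v * cnj (transition_matrix E t $ u $ v))"

definition average_mixing_matrix :: "('v::finite \<Rightarrow> 'v \<Rightarrow> bool) \<Rightarrow> complex^'v^'v" where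
  "average_mixing_matrix E =
     Lim at_top (\<lambda>T::real. (1 / T) *\<^sub>R integral {0..T} (mixing_matrix E))"

end

theory Submission
  imports Defs
begin

text \<open>
  If \<open>P\<close> is a unitary matrix of eigenvectors, then simplicity of the spectrum makes the average mixing
  matrix equal to \<open>N N\<^sup>T\<close> with \<open>N u r = \<bar>P u r\<bar>\<^sup>2\<close>. A linear relation between rows of the average mixing
  matrix is therefore a relation between the same rows of \<open>N\<close>, and hence between the numbers of closed
  walks \<open>(A\<^sup>k) u u = (\<Sum>r. \<theta> r ^ k * N u r)\<close>, for every \<open>k\<close>. If the rank is at most two, then for any
  three vertices the vectors of closed walk counts of lengths 0, 2 and 4 are linearly dependent. In a tree
  these are 1, the degree \<open>d u\<close>, and \<open>d u * (d u - 1)\<close> plus the sum of the degrees of the neighbours.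

  Comparing two leaves with a third vertex shows that all neighbours of leaves have the same degree.
  If this degree exceeded two, both ends of a longest path would carry twin leaves, giving two
  independent vectors in the kernel of \<open>A\<close>. Hence a longest path begins \<open>a, b, c\<close> with \<open>d b = 2\<close>, and
  the relation for \<open>a, b, c\<close> forces all other neighbours of \<open>c\<close> to be leaves. Then \<open>c\<close> is itself a neighbour
  of a leaf, so \<open>d c = 2\<close> and the tree is \<open>P\<^sub>4\<close>.
\<close>

section \<open>Powers and exponentials in a unitary eigenbasis\<close>

text \<open>Entrywise form of \<open>A = P D P\<^sup>*\<close> with \<open>P\<close> unitary and
  \<open>D\<close> real diagonal. Column \<open>r\<close> of \<open>P\<close> is a unit eigenvector
  for \<open>\<theta> r\<close>, and injectivity of \<open>\<theta>\<close> encodes the simple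
  spectrum.\<close>

locale unitary_diagonalization =
  fixes A P :: "complex^'n^'n" and \<theta> :: "'n \<Rightarrow> real"
  assumes entries: "A $ u $ v = (\<Sum>r\<in>UNIV. \<theta> r * P $ u $ r * cnj (P $ v $ r))"
    and orthonormal_columns: "(\<Sum>u\<in>UNIV. P $ u $ r * cnj (P $ u $ s)) = of_bool (r = s)"
    and orthonormal_rows: "(\<Sum>r\<in>UNIV. P $ u $ r * cnj (P $ v $ r)) = of_bool (u = v)"
    and inj_eigenvalues: "inj \<theta>"
begin

text \<open>Any \<open>B\<close> diagonalised by the same \<open>P\<close> is allowed, with complex
  \<open>\<mu>\<close>, so that both the walk counts of \<open>A\<close> and the exponential of
  \<open>i t A\<close> are covered.\<close>

lemma matrix_power_entries:
  assumes B: "\<And>u v. B $ u $ v = (\<Sum>r\<in>UNIV. \<mu> r * P $ u $ r * cnj (P $ v $ r))"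
  shows "(((**) B) ^^ k) (mat 1) $ u $ v = (\<Sum>r\<in>UNIV. \<mu> r ^ k * P $ u $ r * cnj (P $ v $ r))"
proof (induction k arbitrary: u)
  case 0
  then show ?case by (simp add: orthonormal_rows mat_def)
next
  case (Suc k)
  have "(((**) B) ^^ Suc k) (mat 1) $ u $ v =
      (\<Sum>w\<in>UNIV. (\<Sum>r\<in>UNIV. \<mu> r * P $ u $ r * cnj (P $ w $ r)) *
        (\<Sum>s\<in>UNIV. \<mu> s ^ k * P $ w $ s * cnj (P $ v $ s)))"
    by (simp add: matrix_matrix_mult_def B Suc.IH)
  also have "\<dots> = (\<Sum>w\<in>UNIV. \<Sum>r\<in>UNIV. \<Sum>s\<in>UNIV.
      \<mu> r * \<mu> s ^ k * P $ u $ r * cnj (P $ v $ s) * (P $ w $ s * cnj (P $ w $ r)))"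
    by (simp add: sum_product mult_ac)
  also have "\<dots> = (\<Sum>r\<in>UNIV. \<Sum>w\<in>UNIV. \<Sum>s\<in>UNIV.
      \<mu> r * \<mu> s ^ k * P $ u $ r * cnj (P $ v $ s) * (P $ w $ s * cnj (P $ w $ r)))"
    by (rule sum.swap)
  also have "\<dots> = (\<Sum>r\<in>UNIV. \<Sum>s\<in>UNIV. \<Sum>w\<in>UNIV.
      \<mu> r * \<mu> s ^ k * P $ u $ r * cnj (P $ v $ s) * (P $ w $ s * cnj (P $ w $ r)))"
    by (intro sum.cong refl sum.swap)
  also have "\<dots> = (\<Sum>r\<in>UNIV. \<Sum>s\<in>UNIV.
      \<mu> r * \<mu> s ^ k * P $ u $ r * cnj (P $ v $ s) * of_bool (s = r))"
    by (simp only: sum_distrib_left [symmetric] orthonormal_columns)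
  also have "\<dots> = (\<Sum>r\<in>UNIV. \<mu> r ^ Suc k * P $ u $ r * cnj (P $ v $ r))"
    by (simp add: of_bool_def if_distrib cong: if_cong)
  finally show ?case .
qed

lemma matrix_exp_entries:
  assumes B: "\<And>u v. B $ u $ v = (\<Sum>r\<in>UNIV. \<mu> r * P $ u $ r * cnj (P $ v $ r))"
  shows "matrix_exp B = (\<chi> u v. \<Sum>r\<in>UNIV. exp (\<mu> r) * P $ u $ r * cnj (P $ v $ r))"
proof -
  have "(\<lambda>k. ((1 / fact k) *\<^sub>R (((**) B) ^^ k) (mat 1)) $ u $ v) sums
      (\<Sum>r\<in>UNIV. exp (\<mu> r) * (P $ u $ r * cnj (P $ v $ r)))" for u v
  proof -
    have "(\<lambda>k. \<Sum>r\<in>UNIV. (\<mu> r ^ k /\<^sub>R fact k) * (P $ u $ r * cnj (P $ v $ r))) sums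
      (\<Sum>r\<in>UNIV. exp (\<mu> r) * (P $ u $ r * cnj (P $ v $ r)))"
      by (intro sums_sum sums_mult2 exp_converges)
    then show ?thesis
      by (simp add: matrix_power_entries [OF B] scaleR_sum_right mult_ac divide_inverse)
  qed
  then have "(\<lambda>k. (1 / fact k) *\<^sub>R (((**) B) ^^ k) (mat 1)) sums
      (\<chi> u v. \<Sum>r\<in>UNIV. exp (\<mu> r) * P $ u $ r * cnj (P $ v $ r))"
    unfolding sums_def by (intro vec_tendstoI) (simp add: mult.assoc)
  then show ?thesis
    unfolding matrix_exp_def by (rule sums_unique [symmetric])
qed

end

section \<open>Time averages and the average mixing matrix\<close>

text \<open>For a nonzero frequency the integral stays bounded by
  \<open>2 / \<bar>\<omega>\<bar>\<close>, so division by \<open>T\<close> sends it to 0; only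
  frequency 0 survives averaging.\<close>

lemma average_of_exp_tendsto:
  fixes \<omega> :: real
  shows "((\<lambda>T. (1 / T) *\<^sub>R integral {0..T} (\<lambda>t. exp (\<i> * t * \<omega>))) \<longlongrightarrow> of_bool (\<omega> = 0)) at_top"
proof (cases "\<omega> = 0")
  case True
  have "eventually (\<lambda>T::real. (1 / T) *\<^sub>R integral {0..T} (\<lambda>t. exp (\<i> * t * \<omega>)) = 1) at_top"
    using eventually_gt_at_top [of 0]
    by eventually_elim (simp add: True scaleR_conv_of_real)
  then show ?thesis
    using True tendsto_eventually by auto
next
  case False
  have bound: "norm ((1 / T) *\<^sub>R integral {0..T} (\<lambda>t. exp (\<i> * t * \<omega>))) \<le> (2 / \<bar>\<omega>\<bar>) / T" if "T > 0" for T
  proof -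
    have "((\<lambda>t. exp (\<i> * t * \<omega>)) has_integral
        exp (\<i> * T * \<omega>) / (\<i> * \<omega>) - exp (\<i> * (0::real) * \<omega>) / (\<i> * \<omega>)) {0..T}"
    proof (rule fundamental_theorem_of_calculus)
      fix t assume "t \<in> {0..T}"
      \<comment> \<open>The antiderivative is differentiated over the complex numbers and then
        restricted to the real line.\<close>
      have "((\<lambda>z. exp (\<i> * z * \<omega>) / (\<i> * \<omega>)) has_field_derivative exp (\<i> * t * \<omega>)) (at (of_real t))"
        using False by (auto intro!: derivative_eq_intros)
      then show "((\<lambda>t. exp (\<i> * of_real t * \<omega>) / (\<i> * \<omega>)) has_vector_derivative exp (\<i> * t * \<omega>))
          (at t within {0..T})"
        using has_vector_derivative_real_field has_vector_derivative_at_within by fastforce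
    qed (use that in simp)
    then have "integral {0..T} (\<lambda>t. exp (\<i> * t * \<omega>)) = (exp (\<i> * T * \<omega>) - 1) / (\<i> * \<omega>)"
      by (simp add: integral_unique diff_divide_distrib)
    moreover have "norm (exp (\<i> * T * \<omega>) - 1) \<le> 2"
      using norm_triangle_ineq4 [of "exp (\<i> * T * \<omega>)" 1] norm_exp_i_times [of "T * \<omega>"]
      by (simp add: mult.assoc)
    ultimately show ?thesis
      using that divide_right_mono [of _ 2 "\<bar>\<omega>\<bar> * T"]
      by (simp add: norm_divide norm_mult mult.commute)
  qed
  have "((\<lambda>T. (2 / \<bar>\<omega>\<bar>) / T) \<longlongrightarrow> 0) at_top"
    by (rule real_tendsto_divide_at_top [OF tendsto_const filterlim_ident])
  then have "((\<lambda>T. (1 / T) *\<^sub>R integral {0..T} (\<lambda>t. exp (\<i> * t * \<omega>))) \<longlongrightarrow> 0) at_top"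
    by (rule Lim_null_comparison [rotated])
      (use bound in \<open>auto intro: eventually_mono [OF eventually_gt_at_top [of 0]]\<close>)
  then show ?thesis
    using False by simp
qed

text \<open>Each entry of the mixing matrix is a trigonometric sum with frequencies
  \<open>\<theta> r - \<theta> s\<close>. Averaging keeps frequency 0, and by injectivity of
  \<open>\<theta>\<close> these are exactly the terms with \<open>r = s\<close>.\<close>

lemma average_mixing_matrix_eq:
  assumes "unitary_diagonalization (adjacency_matrix E) P \<theta>"
  shows "average_mixing_matrix E =
    (\<chi> u v. \<Sum>r\<in>UNIV. of_real ((norm (P $ u $ r))\<^sup>2 * (norm (P $ v $ r))\<^sup>2))"
proof -
  interpret unitary_diagonalization "adjacency_matrix E" P \<theta> by fact
  define c where "c = (\<lambda>u v r s. P $ u $ r * cnj (P $ v $ r) * (cnj (P $ u $ s) * P $ v $ s))"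
  have transition: "transition_matrix E t =
      (\<chi> u v. \<Sum>r\<in>UNIV. exp (\<i> * t * \<theta> r) * P $ u $ r * cnj (P $ v $ r))" for t
    unfolding transition_matrix_def
    by (rule matrix_exp_entries)
      (simp add: map_matrix_def entries sum_distrib_left mult.assoc)
  have mixing: "mixing_matrix E t $ u $ v =
      (\<Sum>r\<in>UNIV. \<Sum>s\<in>UNIV. exp (\<i> * t * of_real (\<theta> r - \<theta> s)) * c u v r s)" for t u v
  proof -
    have "exp (\<i> * t * of_real (\<theta> r - \<theta> s)) = exp (\<i> * t * \<theta> r) * exp (- (\<i> * t * \<theta> s))" for r s
      by (simp add: exp_add [symmetric] algebra_simps)
    then show ?thesis
      by (simp add: mixing_matrix_def transition sum_product exp_cnj c_def mult_ac)
  qed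
  \<comment> \<open>Continuity gives integrability, which allows the matrix-valued integral to be
    computed entry by entry.\<close>
  have continuous: "continuous_on S (mixing_matrix E)" for S
  proof -
    have "continuous_on S (\<lambda>t. \<chi> u v. \<Sum>r\<in>UNIV. \<Sum>s\<in>UNIV.
        exp (\<i> * complex_of_real t * of_real (\<theta> r - \<theta> s)) * c u v r s)"
      by (intro continuous_intros)
    also have "(\<lambda>t. \<chi> u v. \<Sum>r\<in>UNIV. \<Sum>s\<in>UNIV.
        exp (\<i> * complex_of_real t * of_real (\<theta> r - \<theta> s)) * c u v r s) = mixing_matrix E"
      by (simp add: fun_eq_iff vec_eq_iff mixing)
    finally show ?thesis .
  qed
  have entry: "integral {0..T} (mixing_matrix E) $ u $ v =
      (\<Sum>r\<in>UNIV. \<Sum>s\<in>UNIV. integral {0..T} (\<lambda>t. exp (\<i> * t * of_real (\<theta> r - \<theta> s))) * c u v r s)"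
    for T u v
  proof -
    have "bounded_linear (\<lambda>M::complex^'a^'a. M $ u $ v)"
      by (intro bounded_linear_compose [OF bounded_linear_vec_nth] bounded_linear_vec_nth)
    then have "integral {0..T} (mixing_matrix E) $ u $ v = integral {0..T} (\<lambda>t. mixing_matrix E t $ u $ v)"
      using integral_linear [OF integrable_continuous_real [OF continuous]] by (fastforce simp: o_def)
    also have "\<dots> = (\<Sum>r\<in>UNIV. \<Sum>s\<in>UNIV.
        integral {0..T} (\<lambda>t. exp (\<i> * t * of_real (\<theta> r - \<theta> s)) * c u v r s))"
      unfolding mixing
      by ((subst integral_sum; (intro finite integrable_continuous_real continuous_intros)?)+) (rule refl)
    finally show ?thesis by simp
  qed
  have "((\<lambda>T. (1 / T) *\<^sub>R integral {0..T} (mixing_matrix E)) \<longlongrightarrow>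
      (\<chi> u v. \<Sum>r\<in>UNIV. of_real ((norm (P $ u $ r))\<^sup>2 * (norm (P $ v $ r))\<^sup>2))) at_top"
  proof (intro vec_tendstoI)
    fix u v
    have "((\<lambda>T. \<Sum>r\<in>UNIV. \<Sum>s\<in>UNIV.
          ((1 / T) *\<^sub>R integral {0..T} (\<lambda>t. exp (\<i> * t * of_real (\<theta> r - \<theta> s)))) * c u v r s) \<longlongrightarrow>
        (\<Sum>r\<in>UNIV. \<Sum>s\<in>UNIV. of_bool (\<theta> r - \<theta> s = 0) * c u v r s)) at_top"
      by (intro tendsto_sum tendsto_mult average_of_exp_tendsto tendsto_const)
    also have "(\<Sum>r\<in>UNIV. \<Sum>s\<in>UNIV. of_bool (\<theta> r - \<theta> s = 0) * c u v r s) = (\<Sum>r\<in>UNIV. c u v r r)"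
      by (simp add: inj_eq [OF inj_eigenvalues] of_bool_def if_distrib if_distribR cong: if_cong)
    also have "\<dots> = (\<Sum>r\<in>UNIV. of_real ((norm (P $ u $ r))\<^sup>2 * (norm (P $ v $ r))\<^sup>2))"
      by (intro sum.cong refl) (simp add: c_def complex_norm_square mult_ac del: of_real_power)
    finally show "((\<lambda>T. ((1 / T) *\<^sub>R integral {0..T} (mixing_matrix E)) $ u $ v) \<longlongrightarrow>
      (\<chi> u v. \<Sum>r\<in>UNIV. complex_of_real ((norm (P $ u $ r))\<^sup>2 * (norm (P $ v $ r))\<^sup>2)) $ u $ v) at_top"
      by (simp add: entry scaleR_sum_right del: of_real_mult of_real_power)
  qed
  then show ?thesis
    unfolding average_mixing_matrix_def by (intro tendsto_Lim) simp_all
qed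

section \<open>Unitary diagonalization and the kernel\<close>

lemma orthonormal_rows_of_columns:
  fixes P :: "complex^'n^'n"
  assumes "\<And>r s. (\<Sum>u\<in>UNIV. P $ u $ r * cnj (P $ u $ s)) = of_bool (r = s)"
  shows "(\<Sum>r\<in>UNIV. P $ u $ r * cnj (P $ v $ r)) = of_bool (u = v)"
proof -
  define Q where "Q = (\<chi> r u. cnj (P $ u $ r))"
  have "Q ** P = mat 1"
    using assms by (auto simp: vec_eq_iff matrix_matrix_mult_def Q_def mat_def mult.commute of_bool_def)
  then have "P ** Q = mat 1"
    by (simp add: matrix_left_right_inverse)
  then have "(P ** Q) $ u $ v = mat 1 $ u $ v"
    by simp
  then show ?thesis
    by (simp add: matrix_matrix_mult_def Q_def mat_def of_bool_def)
qed

text \<open>There are as many eigenvalues as indices, so one unit eigenvector for each eigenvalue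
  fills the columns of a square matrix \<open>P\<close>.\<close>

lemma hermitian_diagonalization:
  fixes A :: "complex^'n^'n"
  assumes hermitian: "\<And>u v. A $ v $ u = cnj (A $ u $ v)"
    and simple: "card (eigenvalues A) = CARD('n)"
  obtains P \<theta> where "unitary_diagonalization A P \<theta>"
proof -
  have "finite (eigenvalues A)"
    using simple by (simp add: card_ge_0_finite)
  then obtain \<mu> :: "'n \<Rightarrow> complex" where \<mu>: "bij_betw \<mu> UNIV (eigenvalues A)"
    using simple finite_same_card_bij [of "UNIV :: 'n set" "eigenvalues A"] by auto
  then have "\<forall>r. \<exists>x. x \<noteq> 0 \<and> A *v x = \<mu> r *s x"
    by (auto simp: bij_betw_def eigenvalues_def)
  then obtain x where x: "\<And>r. x r \<noteq> 0" "\<And>r. A *v x r = \<mu> r *s x r"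
    by metis
  define P :: "complex^'n^'n" where "P = (\<chi> u r. x r $ u / norm (x r))"
  have eigen: "(\<Sum>v\<in>UNIV. A $ u $ v * P $ v $ r) = \<mu> r * P $ u $ r" for u r
  proof -
    have "(\<Sum>v\<in>UNIV. A $ u $ v * x r $ v) = \<mu> r * x r $ u"
      using x(2) [of r] by (simp add: vec_eq_iff matrix_vector_mult_def)
    then show ?thesis
      by (simp add: P_def sum_divide_distrib [symmetric])
  qed
  have norm: "(\<Sum>u\<in>UNIV. P $ u $ r * cnj (P $ u $ r)) = 1" for r
  proof -
    have "(\<Sum>u\<in>UNIV. (norm (x r $ u))\<^sup>2) = (norm (x r))\<^sup>2"
      by (simp add: norm_vec_def L2_set_def sum_nonneg)
    moreover have "P $ u $ r * cnj (P $ u $ r) = of_real ((norm (x r $ u))\<^sup>2 / (norm (x r))\<^sup>2)" for u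
      by (simp add: P_def complex_norm_square [symmetric] power2_eq_square [symmetric] del: of_real_power)
         (simp add: power2_eq_square)
    ultimately show ?thesis
      using x(1) [of r]
      by (simp add: sum_divide_distrib [symmetric] of_real_sum [symmetric] del: of_real_sum of_real_power of_real_divide)
  qed
  \<comment> \<open>Moving \<open>A\<close> across the inner product. For \<open>r = s\<close> this
    shows that the eigenvalue is real; for \<open>r \<noteq> s\<close> it gives
    orthogonality.\<close>
  have swap: "\<mu> r * (\<Sum>u\<in>UNIV. P $ u $ r * cnj (P $ u $ s)) =
      cnj (\<mu> s) * (\<Sum>u\<in>UNIV. P $ u $ r * cnj (P $ u $ s))" for r s
  proof -
    have "\<mu> r * (\<Sum>u\<in>UNIV. P $ u $ r * cnj (P $ u $ s)) =
        (\<Sum>u\<in>UNIV. \<Sum>v\<in>UNIV. A $ u $ v * P $ v $ r * cnj (P $ u $ s))"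
      by (simp add: sum_distrib_left sum_distrib_right [symmetric] eigen mult.assoc [symmetric])
    also have "\<dots> = (\<Sum>v\<in>UNIV. \<Sum>u\<in>UNIV. A $ u $ v * P $ v $ r * cnj (P $ u $ s))"
      by (rule sum.swap)
    also have "\<dots> = (\<Sum>v\<in>UNIV. P $ v $ r * cnj (\<Sum>u\<in>UNIV. A $ v $ u * P $ u $ s))"
      by (simp add: sum_distrib_left hermitian [symmetric] mult_ac)
    also have "\<dots> = cnj (\<mu> s) * (\<Sum>u\<in>UNIV. P $ u $ r * cnj (P $ u $ s))"
      by (simp add: eigen sum_distrib_left mult_ac)
    finally show ?thesis .
  qed
  have cnj_eigenvalue: "cnj (\<mu> r) = \<mu> r" for r
    using swap [of r r] by (simp add: norm)
  then have real: "of_real (Re (\<mu> r)) = \<mu> r" for r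
    by (metis Reals_cnj_iff of_real_Re)
  have inj: "\<mu> r = \<mu> s \<longleftrightarrow> r = s" for r s
    using \<mu> by (auto simp: bij_betw_def inj_eq)
  have orthonormal: "(\<Sum>u\<in>UNIV. P $ u $ r * cnj (P $ u $ s)) = of_bool (r = s)" for r s
  proof (cases "r = s")
    case False
    then show ?thesis
      using swap [of r s] by (simp add: cnj_eigenvalue inj)
  qed (simp add: norm)
  have "unitary_diagonalization A P (\<lambda>r. Re (\<mu> r))"
  proof
    show rows: "(\<Sum>r\<in>UNIV. P $ u $ r * cnj (P $ v $ r)) = of_bool (u = v)" for u v
      by (rule orthonormal_rows_of_columns [OF orthonormal])
    \<comment> \<open>Since \<open>P D = A P\<close>, the sum is an entry of
      \<open>A P P\<^sup>*\<close>, which orthonormality of the rows reduces to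
      \<open>A\<close>.\<close>
    have "(\<Sum>r\<in>UNIV. Re (\<mu> r) * P $ u $ r * cnj (P $ v $ r)) =
        (\<Sum>r\<in>UNIV. \<Sum>w\<in>UNIV. A $ u $ w * (P $ w $ r * cnj (P $ v $ r)))" for u v
      by (simp add: real eigen [symmetric] sum_distrib_right mult.assoc)
    also have "\<dots> u v = (\<Sum>w\<in>UNIV. \<Sum>r\<in>UNIV. A $ u $ w * (P $ w $ r * cnj (P $ v $ r)))" for u v
      by (rule sum.swap)
    also have "\<dots> u v = A $ u $ v" for u v
      by (simp add: sum_distrib_left [symmetric] rows of_bool_def if_distrib cong: if_cong)
    finally show "A $ u $ v = (\<Sum>r\<in>UNIV. Re (\<mu> r) * P $ u $ r * cnj (P $ v $ r))" for u v
      by simp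
    show "inj (\<lambda>r. Re (\<mu> r))"
    proof (rule injI)
      fix r s assume "Re (\<mu> r) = Re (\<mu> s)"
      then have "\<mu> r = \<mu> s"
        by (metis real)
      then show "r = s"
        by (simp add: inj)
    qed
  qed (rule orthonormal)
  then show thesis by (rule that)
qed

text \<open>At most one \<open>\<theta> r\<close> is zero, so the kernel is at most one-dimensional;
  this is expressed by the vanishing of all 2 by 2 minors.\<close>

lemma (in unitary_diagonalization) kernel_proportional:
  assumes "A *v x = 0" and "A *v y = 0"
  shows "x $ u * y $ v = x $ v * y $ u"
proof -
  \<comment> \<open>\<open>a z r\<close> is the coordinate of \<open>z\<close> along the eigenvector
    in column \<open>r\<close>.\<close>
  define a where "a = (\<lambda>z r. \<Sum>w\<in>UNIV. cnj (P $ w $ r) * z $ w)"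
  have expansion: "z $ u = (\<Sum>r\<in>UNIV. P $ u $ r * a z r)" for z u
  proof -
    have "(\<Sum>r\<in>UNIV. P $ u $ r * a z r) =
        (\<Sum>w\<in>UNIV. \<Sum>r\<in>UNIV. P $ u $ r * cnj (P $ w $ r) * z $ w)"
      unfolding a_def sum_distrib_left mult.assoc by (rule sum.swap)
    then show ?thesis
      by (simp add: sum_distrib_right [symmetric] orthonormal_rows of_bool_def if_distrib if_distribR cong: if_cong)
  qed
  have coefficient: "\<theta> r * a z r = 0" if "A *v z = 0" for z r
  proof -
    have zero: "(\<Sum>s\<in>UNIV. \<theta> s * P $ u $ s * a z s) = 0" for u
    proof -
      have "(\<Sum>s\<in>UNIV. \<theta> s * P $ u $ s * a z s) =
          (\<Sum>w\<in>UNIV. \<Sum>s\<in>UNIV. \<theta> s * P $ u $ s * cnj (P $ w $ s) * z $ w)"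
        unfolding sum_distrib_left a_def mult.assoc by (rule sum.swap)
      also have "\<dots> = (A *v z) $ u"
        by (simp add: sum_distrib_right [symmetric] entries matrix_vector_mult_def)
      finally show ?thesis using that by simp
    qed
    have "\<theta> r * a z r = (\<Sum>s\<in>UNIV. \<theta> s * a z s * (\<Sum>u\<in>UNIV. P $ u $ s * cnj (P $ u $ r)))"
      by (simp add: orthonormal_columns of_bool_def if_distrib cong: if_cong)
    also have "\<dots> = (\<Sum>u\<in>UNIV. \<Sum>s\<in>UNIV. \<theta> s * a z s * (P $ u $ s * cnj (P $ u $ r)))"
      unfolding sum_distrib_left by (rule sum.swap)
    also have "\<dots> = (\<Sum>u\<in>UNIV. cnj (P $ u $ r) * (\<Sum>s\<in>UNIV. \<theta> s * P $ u $ s * a z s))"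
      by (simp add: sum_distrib_left mult_ac)
    also have "\<dots> = 0"
      by (simp add: zero)
    finally show ?thesis .
  qed
  \<comment> \<open>If \<open>\<theta> r\<close> or \<open>\<theta> s\<close> is nonzero, the
    coordinates of both kernel vectors at that index vanish and both sides are 0.\<close>
  have cross: "a x r * a y s = a x s * a y r" for r s
  proof (cases "\<theta> r = 0 \<and> \<theta> s = 0")
    case True
    then have "r = s" by (metis inj_eigenvalues injD)
    then show ?thesis by simp
  next
    case False
    then show ?thesis
      using coefficient [OF assms(1), of r] coefficient [OF assms(1), of s]
        coefficient [OF assms(2), of r] coefficient [OF assms(2), of s]
      by auto
  qed
  have "x $ u * y $ v = (\<Sum>r\<in>UNIV. \<Sum>s\<in>UNIV. P $ u $ r * P $ v $ s * (a x r * a y s))"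
    unfolding expansion [of x] expansion [of y] sum_product by (simp add: mult_ac)
  also have "\<dots> = (\<Sum>r\<in>UNIV. \<Sum>s\<in>UNIV. P $ u $ r * P $ v $ s * (a x s * a y r))"
    by (simp only: cross)
  also have "\<dots> = y $ u * x $ v"
    unfolding expansion [of x] expansion [of y] sum_product by (simp add: mult_ac)
  finally show ?thesis by (simp add: mult.commute)
qed

section \<open>Linear relations between rows\<close>

lemma rank_less_card_imp_row_relation:
  fixes M :: "'a::field^'n^'m"
  assumes "rank M < card S" and "finite S"
  obtains z where "\<exists>u\<in>S. z u \<noteq> 0" and "\<And>v. (\<Sum>u\<in>S. z u * M $ u $ v) = 0"
\<comment> \<open>Linear dependence concerns the set of rows and does not see repetitions; two equal
  rows give a relation directly, with coefficients 1 and -1.\<close>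
proof (cases "inj_on (\<lambda>u. row u M) S")
  case True
  let ?R = "(\<lambda>u. row u M) ` S"
  have "card ?R = card S"
    using True by (rule card_image)
  moreover have "card ?R \<le> rank M" if "vec.independent ?R"
    unfolding row_rank_def_gen
    by (rule vec.independent_card_le_dim [OF _ that]) (auto simp: rows_def)
  ultimately have "vec.dependent ?R"
    using assms by auto
  then obtain f where f: "\<exists>x\<in>?R. f x \<noteq> 0" "(\<Sum>x\<in>?R. f x *s x) = 0"
    using assms by (auto simp: vec.dependent_finite)
  have "(\<Sum>u\<in>S. f (row u M) *s row u M) = 0"
    using f(2) True by (simp add: sum.reindex)
  then have "(\<Sum>u\<in>S. f (row u M) * M $ u $ v) = 0" for v
    by (auto simp: vec_eq_iff row_def)
  then show thesis
    using f(1) by (intro that [of "\<lambda>u. f (row u M)"]) auto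
next
  case False
  then obtain a b where ab: "a \<in> S" "b \<in> S" "a \<noteq> b" "row a M = row b M"
    by (auto simp: inj_on_def)
  define z :: "'m \<Rightarrow> 'a" where "z = (\<lambda>u. if u = a then 1 else if u = b then - 1 else 0)"
  have "M $ a $ v = M $ b $ v" for v
    using ab(4) by (simp add: row_def vec_eq_iff)
  moreover have "(\<Sum>u\<in>S. z u * M $ u $ v) = (\<Sum>u\<in>{a, b}. z u * M $ u $ v)" for v
    using ab assms by (intro sum.mono_neutral_right) (auto simp: z_def)
  ultimately have "(\<Sum>u\<in>S. z u * M $ u $ v) = 0" for v
    using ab by (simp add: z_def)
  moreover have "z a \<noteq> 0"
    using ab by (simp add: z_def)
  ultimately show thesis
    using ab(1) that by blast
qed

text \<open>The kernels of \<open>N N\<^sup>T\<close> and \<open>N\<^sup>T\<close> agree because \<open>N\<close> is real.\<close>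

lemma gram_row_relation:
  fixes N :: "'m::finite \<Rightarrow> 'n::finite \<Rightarrow> real" and z :: "'m \<Rightarrow> complex"
  assumes "\<And>v. (\<Sum>u\<in>S. z u * of_real (\<Sum>r\<in>UNIV. N u r * N v r)) = 0"
  shows "(\<Sum>u\<in>S. z u * of_real (N u r)) = 0"
proof -
  define y where "y = (\<lambda>r. \<Sum>u\<in>S. z u * of_real (N u r))"
  have orthogonal: "(\<Sum>r\<in>UNIV. N v r * y r) = 0" for v
  proof -
    have "(\<Sum>r\<in>UNIV. N v r * y r) = (\<Sum>u\<in>S. \<Sum>r\<in>UNIV. N v r * (z u * of_real (N u r)))"
      unfolding y_def sum_distrib_left by (rule sum.swap)
    also have "\<dots> = (\<Sum>u\<in>S. z u * of_real (\<Sum>r\<in>UNIV. N u r * N v r))"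
      by (simp add: sum_distrib_left mult_ac)
    finally show ?thesis using assms by simp
  qed
  \<comment> \<open>As \<open>N\<close> is real, the conjugate of \<open>y\<close> is also a
    combination of rows of \<open>N\<close>, so \<open>y\<close> is orthogonal to itself.\<close>
  have "of_real (\<Sum>r\<in>UNIV. (norm (y r))\<^sup>2) = (\<Sum>r\<in>UNIV. y r * cnj (y r))"
    by (simp add: complex_norm_square del: of_real_power)
  also have "\<dots> = (\<Sum>r\<in>UNIV. \<Sum>u\<in>S. cnj (z u) * (N u r * y r))"
    by (subst (2) y_def) (simp add: sum_distrib_left mult_ac)
  also have "\<dots> = (\<Sum>u\<in>S. \<Sum>r\<in>UNIV. cnj (z u) * (N u r * y r))"
    by (rule sum.swap)
  also have "\<dots> = 0"
    by (simp add: sum_distrib_left [symmetric] orthogonal)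
  finally have "(\<Sum>r\<in>UNIV. (norm (y r))\<^sup>2) = 0"
    by (simp only: of_real_eq_0_iff)
  then show ?thesis
    by (simp add: sum_nonneg_eq_0_iff y_def)
qed

section \<open>Counting closed walks\<close>

definition neighbours :: "('v \<Rightarrow> 'v \<Rightarrow> bool) \<Rightarrow> 'v \<Rightarrow> 'v set" where
  "neighbours E u = {v. E u v}"

abbreviation degree :: "('v \<Rightarrow> 'v \<Rightarrow> bool) \<Rightarrow> 'v \<Rightarrow> nat" where
  "degree E u \<equiv> card (neighbours E u)"

abbreviation closed_walks :: "('v::finite \<Rightarrow> 'v \<Rightarrow> bool) \<Rightarrow> nat \<Rightarrow> 'v \<Rightarrow> complex" where
  "closed_walks E k u \<equiv> (((**) (adjacency_matrix E)) ^^ k) (mat 1) $ u $ u"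

text \<open>One \<open>z\<close> serves every \<open>k\<close>: it annihilates each column of
  \<open>N\<close>, and the walk counts are combinations of these columns with weights
  \<open>\<theta> r ^ k\<close>.\<close>

lemma closed_walks_relation:
  assumes diag: "unitary_diagonalization (adjacency_matrix E) P \<theta>"
    and rank: "rank (average_mixing_matrix E) < card S"
  obtains z where "\<exists>u\<in>S. z u \<noteq> 0" and "\<And>k. (\<Sum>u\<in>S. z u * closed_walks E k u) = 0"
proof -
  interpret unitary_diagonalization "adjacency_matrix E" P \<theta> by (rule diag)
  have "finite S"
    using rank card.infinite by fastforce
  then obtain z where nonzero: "\<exists>u\<in>S. z u \<noteq> 0"
    and z: "\<And>v. (\<Sum>u\<in>S. z u * average_mixing_matrix E $ u $ v) = 0"
    using rank_less_card_imp_row_relation [OF rank] by blast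
  have null: "(\<Sum>u\<in>S. z u * of_real ((norm (P $ u $ r))\<^sup>2)) = 0" for r
    by (rule gram_row_relation [where N = "\<lambda>u r. (norm (P $ u $ r))\<^sup>2"])
      (use z in \<open>simp add: average_mixing_matrix_eq [OF diag]\<close>)
  have "(\<Sum>u\<in>S. z u * closed_walks E k u) = 0" for k
  proof -
    have "(\<Sum>u\<in>S. z u * closed_walks E k u) =
        (\<Sum>u\<in>S. \<Sum>r\<in>UNIV. of_real (\<theta> r) ^ k * (z u * of_real ((norm (P $ u $ r))\<^sup>2)))"
      by (simp add: matrix_power_entries [OF entries] complex_norm_square sum_distrib_left mult_ac
          del: of_real_power)
    also have "\<dots> = (\<Sum>r\<in>UNIV. \<Sum>u\<in>S. of_real (\<theta> r) ^ k * (z u * of_real ((norm (P $ u $ r))\<^sup>2)))"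
      by (rule sum.swap)
    finally show ?thesis
      by (simp add: sum_distrib_left [symmetric] null del: of_real_power)
  qed
  then show thesis
    using nonzero that by blast
qed

text \<open>This is the vanishing of the 3 by 3 determinant with a row of ones (closed walks of
  length 0) and the rows of lengths \<open>j\<close> and \<open>k\<close>, after subtracting the
  column of \<open>a\<close>.\<close>

lemma closed_walks_determinant:
  assumes "unitary_diagonalization (adjacency_matrix E) P \<theta>"
    and "rank (average_mixing_matrix E) < 3"
    and distinct: "a \<noteq> b" "a \<noteq> c" "b \<noteq> c"
  shows "(closed_walks E j b - closed_walks E j a) * (closed_walks E k c - closed_walks E k a) =
    (closed_walks E j c - closed_walks E j a) * (closed_walks E k b - closed_walks E k a)"
proof -
  have "rank (average_mixing_matrix E) < card {a, b, c}"
    using assms by simp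
  then obtain z where nonzero: "\<exists>u\<in>{a, b, c}. z u \<noteq> 0"
    and z: "\<And>k. (\<Sum>u\<in>{a, b, c}. z u * closed_walks E k u) = 0"
    using closed_walks_relation [OF assms(1)] by blast
  have walks: "z a * closed_walks E k a + z b * closed_walks E k b + z c * closed_walks E k c = 0" for k
    using z [of k] distinct by (simp add: add.assoc)
  have "z a + z b + z c = 0"
    using walks [of 0] by (simp add: mat_def)
  then have za: "z a = - z b - z c"
    by (simp add: eq_neg_iff_add_eq_0 algebra_simps)
  have reduced: "z b * (closed_walks E k b - closed_walks E k a) =
      - z c * (closed_walks E k c - closed_walks E k a)" for k
    using walks [of k] unfolding za by (simp add: algebra_simps eq_neg_iff_add_eq_0)
  show ?thesis
  proof (cases "z b = 0")
    case True
    then have "z c \<noteq> 0"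
      using nonzero za by auto
    then show ?thesis
      using reduced [of j] reduced [of k] True by simp
  next
    case False
    have "z b * ((closed_walks E j b - closed_walks E j a) * (closed_walks E k c - closed_walks E k a)) =
      z b * ((closed_walks E j c - closed_walks E j a) * (closed_walks E k b - closed_walks E k a))"
      using reduced [of j] reduced [of k] by algebra
    then show ?thesis
      using False by simp
  qed
qed

lemma walks_Suc:
  "(((**) (adjacency_matrix E)) ^^ Suc k) (mat 1) $ u $ v =
    (\<Sum>w\<in>neighbours E u. (((**) (adjacency_matrix E)) ^^ k) (mat 1) $ w $ v)"
proof -
  have "(((**) (adjacency_matrix E)) ^^ Suc k) (mat 1) $ u $ v =
      (\<Sum>w\<in>UNIV. if w \<in> neighbours E u then (((**) (adjacency_matrix E)) ^^ k) (mat 1) $ w $ v else 0)"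
    by (simp add: matrix_matrix_mult_def adjacency_matrix_def neighbours_def if_distribR if_distrib cong: if_cong)
  then show ?thesis
    by (simp add: sum.If_cases)
qed

lemma walks_of_length_2:
  assumes "symp E"
  shows "(((**) (adjacency_matrix E)) ^^ 2) (mat 1) $ u $ v = of_nat (card (neighbours E u \<inter> neighbours E v))"
proof -
  have "(((**) (adjacency_matrix E)) ^^ Suc 0) (mat 1) $ w $ v = of_bool (w \<in> neighbours E v)" for w
    unfolding walks_Suc
    using sympD [OF assms, of w v] sympD [OF assms, of v w] by (auto simp: mat_def neighbours_def)
  then have "(((**) (adjacency_matrix E)) ^^ Suc (Suc 0)) (mat 1) $ u $ v =
      (\<Sum>w\<in>neighbours E u. of_bool (w \<in> neighbours E v))"
    unfolding walks_Suc [of "Suc 0"] by simp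
  also have "\<dots> = of_nat (card (neighbours E u \<inter> neighbours E v))"
    by (simp add: of_bool_def sum.If_cases)
  finally show ?thesis
    by (simp add: numeral_2_eq_2)
qed

text \<open>A closed walk \<open>u, y, z, w, u\<close> is sorted by \<open>y\<close> and
  \<open>w\<close>; the middle vertex \<open>z\<close> is any common neighbour of the two.\<close>

lemma closed_walks_4:
  assumes "symp E"
  shows "closed_walks E 4 u =
    of_nat (\<Sum>y\<in>neighbours E u. \<Sum>w\<in>neighbours E u. card (neighbours E y \<inter> neighbours E w))"
proof -
  have 4: "4 = Suc (Suc 2)" by simp
  have common: "card (neighbours E z \<inter> neighbours E u) = (\<Sum>w\<in>neighbours E u. of_bool (E z w))" for z
    by (simp add: of_bool_def sum.If_cases neighbours_def Int_def conj_commute)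
  have common': "(\<Sum>z\<in>neighbours E y. of_bool (E z w)) = card (neighbours E y \<inter> neighbours E w)" for y w
    using sympD [OF assms, of w] sympD [OF assms, of _ w]
    by (auto simp: of_bool_def sum.If_cases neighbours_def Int_def intro!: arg_cong [where f = card])
  \<comment> \<open>\<open>walks_Suc\<close> peels off the first steps and leaves a sum over
    \<open>z\<close>; exchanging the sums gives the form symmetric in \<open>y\<close> and
    \<open>w\<close>.\<close>
  have "(\<Sum>z\<in>neighbours E y. card (neighbours E z \<inter> neighbours E u)) =
      (\<Sum>w\<in>neighbours E u. \<Sum>z\<in>neighbours E y. of_bool (E z w))" for y
    unfolding common by (rule sum.swap)
  then have "(\<Sum>z\<in>neighbours E y. card (neighbours E z \<inter> neighbours E u)) =
      (\<Sum>w\<in>neighbours E u. card (neighbours E y \<inter> neighbours E w))" for y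
    unfolding common' .
  then show ?thesis
    unfolding 4 walks_Suc walks_of_length_2 [OF assms] by (simp flip: of_nat_sum)
qed

section \<open>Local structure of trees\<close>

locale tree =
  fixes E :: "'v::finite \<Rightarrow> 'v \<Rightarrow> bool"
  assumes tree: "tree_graph E"
begin

lemma symp: "symp E"
  using tree by (simp add: tree_graph_def simple_graph_def)

lemma sym: "E u v \<Longrightarrow> E v u"
  using symp by (rule sympD)

lemma adjacent_commute: "E u v \<longleftrightarrow> E v u"
  using sym by blast

lemma irrefl: "\<not> E u u"
  using tree by (simp add: tree_graph_def simple_graph_def irreflpD)

lemma mem_neighbours [simp]: "v \<in> neighbours E u \<longleftrightarrow> E u v"
  by (simp add: neighbours_def)

text \<open>Connectedness in the form used to show that a few explicit vertices already exhaust the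
  tree.\<close>

lemma closed_set_eq_UNIV:
  assumes "a \<in> S" and "\<And>u v. u \<in> S \<Longrightarrow> E u v \<Longrightarrow> v \<in> S"
  shows "S = UNIV"
proof -
  have "v \<in> S" for v
  proof -
    have "E\<^sup>*\<^sup>* a v"
      using tree by (simp add: tree_graph_def connected_graph_def)
    then show ?thesis
      by (induction rule: rtranclp_induct) (use assms in auto)
  qed
  then show ?thesis by auto
qed

text \<open>A chord from \<open>x\<close> to \<open>u\<close> would close the initial segment ending
  at \<open>u\<close> into a cycle.\<close>

lemma path_has_no_chord:
  assumes path: "successively E (x # y # r)" "distinct (x # y # r)" and "u \<in> set r"
  shows "\<not> E x u"
proof
  assume chord: "E x u"
  obtain j where j: "j < length r" "u = r ! j"
    using \<open>u \<in> set r\<close> by (auto simp: in_set_conv_nth)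
  define p where "p = x # y # r"
  \<comment> \<open>\<open>u = r ! j\<close> has index \<open>j + 2\<close> in \<open>p\<close>, so
    the segment ending at \<open>u\<close> has \<open>j + 3\<close> vertices.\<close>
  define c where "c = take (j + 3) p"
  have len: "length c = j + 3"
    using j by (simp add: c_def p_def)
  have nth: "c ! i = p ! i" if "i < j + 3" for i
    using that by (simp add: c_def)
  have "E (c ! i) (c ! (Suc i mod length c))" if "i < length c" for i
  proof (cases "Suc i < length c")
    case True
    then have "E (p ! i) (p ! Suc i)"
      using path(1) j len by (simp add: successively_conv_nth p_def [symmetric]) (simp add: p_def)
    then show ?thesis
      using True by (simp add: nth len)
  next
    case False
    then have i: "Suc i = length c" using that by simp
    then have "c ! i = u"
      using len nth [of i] j by (simp add: p_def)
    moreover have "c ! 0 = x"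
      using nth [of 0] by (simp add: p_def)
    ultimately show ?thesis
      using sym [OF chord] by (simp add: i)
  qed
  moreover have "distinct c"
    using path(2) by (simp add: c_def p_def [symmetric])
  ultimately have "graph_cycle E c"
    using len by (simp add: graph_cycle_def)
  then show False
    using tree by (auto simp: tree_graph_def)
qed

text \<open>A second common neighbour \<open>x\<close> would produce the 4-cycle
  \<open>u, y, x, w\<close>.\<close>

lemma common_neighbour_unique:
  assumes "E u y" "E u w" "y \<noteq> w"
  shows "neighbours E y \<inter> neighbours E w = {u}"
proof -
  have "x = u" if "E y x" "E w x" for x
  proof (rule ccontr)
    assume "x \<noteq> u"
    then have "distinct [u, y, x, w]"
      using assms that irrefl by auto
    moreover have "successively E [u, y, x, w]"
      using assms that sym [OF that(2)] by simp
    ultimately show False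
      using path_has_no_chord [of u y "[x, w]" w] assms by simp
  qed
  then show ?thesis
    using sym [OF assms(1)] sym [OF assms(2)] unfolding neighbours_def by blast
qed

lemma closed_walks_2_eq_degree: "closed_walks E 2 u = of_nat (degree E u)"
  by (simp add: walks_of_length_2 symp)

text \<open>For fixed \<open>y\<close>, the choice \<open>w = y\<close> contributes
  \<open>degree E y\<close> and each other \<open>w\<close> contributes 1. Truncated subtraction is
  harmless: at degree 0 the sum is empty.\<close>

lemma closed_walks_4_tree:
  "closed_walks E 4 u = of_nat (\<Sum>y\<in>neighbours E u. degree E y + (degree E u - 1))"
proof -
  have "(\<Sum>w\<in>neighbours E u. card (neighbours E y \<inter> neighbours E w)) = degree E y + (degree E u - 1)"
    if "E u y" for y
  proof -
    have "(\<Sum>w\<in>neighbours E u - {y}. card (neighbours E y \<inter> neighbours E w)) =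
        (\<Sum>w\<in>neighbours E u - {y}. 1)"
      using that by (intro sum.cong refl) (auto simp: common_neighbour_unique)
    then show ?thesis
      using that by (subst sum.remove [of _ y]) (auto simp: card_Diff_singleton)
  qed
  then show ?thesis
    by (simp add: closed_walks_4 symp)
qed

section \<open>Longest paths and twin leaves\<close>

definition is_path :: "'v list \<Rightarrow> bool" where
  "is_path p \<longleftrightarrow> successively E p \<and> distinct p"

definition longest_path :: "'v list \<Rightarrow> bool" where
  "longest_path p \<longleftrightarrow> is_path p \<and> (\<forall>q. is_path q \<longrightarrow> length q \<le> length p)"

lemma is_path_rev: "is_path (rev p) \<longleftrightarrow> is_path p"
proof -
  have converse: "(\<lambda>x y. E y x) = E"
    by (intro ext) (rule adjacent_commute)
  show ?thesis
    unfolding is_path_def successively_rev converse distinct_rev ..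
qed

lemma longest_path_rev: "longest_path p \<Longrightarrow> longest_path (rev p)"
  by (simp add: longest_path_def is_path_rev)

lemma is_path_Cons: "is_path (x # y # r) \<longleftrightarrow> E x y \<and> x \<notin> set (y # r) \<and> is_path (y # r)"
  by (auto simp: is_path_def)

lemma longest_path_exists: "\<exists>p. longest_path p"
proof -
  have "\<forall>p. is_path p \<longrightarrow> length p < Suc CARD('v)"
    by (auto simp: is_path_def distinct_card [symmetric] less_Suc_eq_le intro!: card_mono)
  moreover have "is_path []"
    by (simp add: is_path_def)
  ultimately show ?thesis
    unfolding longest_path_def using ex_has_greatest_nat [of is_path "[]" length] by blast
qed

text \<open>Any further neighbour of \<open>a\<close> would either be the end of a chord or extend
  the path.\<close>

lemma longest_path_end:
  assumes "longest_path (a # b # r)"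
  shows "neighbours E a = {b}"
proof -
  have path: "is_path (a # b # r)"
    using assms by (simp add: longest_path_def)
  have "u = b" if "E a u" for u
  proof (rule ccontr)
    assume "u \<noteq> b"
    then have "u \<notin> set (a # b # r)"
      using path_has_no_chord [of a b r u] path that irrefl by (auto simp: is_path_def)
    then have "is_path (u # a # b # r)"
      using path sym [OF that] by (simp add: is_path_Cons [of u])
    then show False
      using assms by (auto simp: longest_path_def)
  qed
  then show ?thesis
    using path unfolding is_path_Cons neighbours_def by blast
qed

text \<open>Replacing \<open>a\<close> by \<open>u\<close> gives a path of the same length, so
  \<open>u\<close> is also an end of a longest path.\<close>

lemma longest_path_sibling:
  assumes longest: "longest_path (a # b # c # r)" and "E b u" "u \<noteq> a" "u \<noteq> c"
  shows "u \<notin> set (a # b # c # r)" and "neighbours E u = {b}"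
proof -
  have path: "is_path (a # b # c # r)"
    using longest by (simp add: longest_path_def)
  then show fresh: "u \<notin> set (a # b # c # r)"
    using assms irrefl path_has_no_chord [of b c r u] by (auto simp: is_path_def)
  have "is_path (u # b # c # r)"
    using path fresh sym [OF \<open>E b u\<close>] by (simp add: is_path_Cons)
  then have "longest_path (u # b # c # r)"
    using longest by (simp add: longest_path_def)
  then show "neighbours E u = {b}"
    by (rule longest_path_end)
qed

text \<open>The vertices of a longest path with one or two vertices would be closed under adjacency,
  hence the whole tree.\<close>

lemma longest_path_length:
  assumes longest: "longest_path p" and card: "CARD('v) \<ge> 3"
  shows "length p \<ge> 3"
proof (rule ccontr)
  assume short: "\<not> length p \<ge> 3"
  have bound: "length q \<le> length p" if "is_path q" for q
    using longest that by (simp add: longest_path_def)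
  consider "p = []" | a where "p = [a]" | a b where "p = [a, b]"
    using short by (cases p; cases "tl p"; cases "tl (tl p)") auto
  then obtain S :: "'v set" where "card S \<le> 2" "S = UNIV"
  proof cases
    case 1
    then show ?thesis using bound [of "[undefined]"] by (simp add: is_path_def)
  next
    case (2 a)
    have "\<not> E a u" for u
      using bound [of "[a, u]"] 2 irrefl by (auto simp: is_path_def)
    then have "{a} = UNIV"
      by (intro closed_set_eq_UNIV) auto
    then show ?thesis by (rule that [rotated]) simp
  next
    case (3 a b)
    then have "neighbours E a = {b}" "neighbours E b = {a}"
      using longest_path_end [of a b "[]"] longest_path_end [of b a "[]"] longest longest_path_rev [OF longest]
      by auto
    then have "{a, b} = UNIV"
      by (intro closed_set_eq_UNIV) (auto simp: neighbours_def)
    then show ?thesis by (rule that [rotated]) (simp add: card_insert_if)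
  qed
  then show False using card by simp
qed

text \<open>Only \<open>b\<close> is adjacent to \<open>a\<close> or \<open>u\<close>, and there the
  two contributions cancel.\<close>

lemma twin_leaves_kernel:
  assumes "neighbours E a = {b}" "neighbours E u = {b}"
  shows "adjacency_matrix E *v (\<chi> v. of_bool (v = a) - of_bool (v = u)) = 0"
proof -
  have "E v a \<longleftrightarrow> v = b" "E v u \<longleftrightarrow> v = b" for v
    using assms unfolding neighbours_def adjacent_commute [of v] by auto
  then show ?thesis
    by (simp add: vec_eq_iff matrix_vector_mult_def right_diff_distrib sum_subtractf)
       (simp add: adjacency_matrix_def)
qed

end

section \<open>Forcing the path on four vertices from rank at most two\<close>

theorem theorem5p7:
  fixes E :: "'v::finite \<Rightarrow> 'v \<Rightarrow> bool"
  assumes "tree_graph E"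
    and "simple_eigenvalues E"
    and "CARD('v) \<ge> 4"
    and "\<not> graph_isomorphic UNIV E {..<4::nat} path_adj"
  shows "rank (average_mixing_matrix E) \<ge> 3"
proof (rule ccontr)
  assume "\<not> rank (average_mixing_matrix E) \<ge> 3"
  then have rank: "rank (average_mixing_matrix E) < 3" by simp
  interpret tree E
    by unfold_locales (rule assms(1))
  have "adjacency_matrix E $ v $ u = cnj (adjacency_matrix E $ u $ v)" for u v
    by (auto simp: adjacency_matrix_def dest: sym)
  then obtain P \<theta> where diag: "unitary_diagonalization (adjacency_matrix E) P \<theta>"
    using hermitian_diagonalization assms(2) unfolding simple_eigenvalues_def by blast
  interpret unitary_diagonalization "adjacency_matrix E" P \<theta> by (rule diag)
  note det = closed_walks_determinant [OF diag rank, where j = 2 and k = 4]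

  \<comment> \<open>Two leaves have equal degree, so one side of \<open>det\<close> vanishes; a leaf
    has as many closed 4-walks as its neighbour has degree. The third vertex \<open>c\<close>
    supplies the nonzero factor \<open>degree E c - 1\<close>.\<close>
  have leaf_neighbours: "degree E b = degree E b'"
    if "neighbours E a = {b}" "neighbours E a' = {b'}" "degree E c \<ge> 2" for a b a' b' c
  proof (cases "a = a'")
    case False
    have "a \<noteq> c" "a' \<noteq> c"
      using that by auto
    then have "(of_nat (degree E c) - 1) * (complex_of_nat (degree E b') - of_nat (degree E b)) = 0"
      using det [of a a' c] False that
      by (simp add: closed_walks_2_eq_degree closed_walks_4_tree)
    then show ?thesis
      using that by auto
  qed (use that in simp)

  obtain p where p: "longest_path p" "length p \<ge> 3"
    using longest_path_exists longest_path_length assms(3) by fastforce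
  obtain a b c r where abc: "p = a # b # c # r"
    using p(2) by (auto simp: numeral_3_eq_3 Suc_le_length_iff)
  obtain a' b' c' r' where abc': "rev p = a' # b' # c' # r'"
    using p(2) length_rev [of p] by (metis (no_types) Suc_le_length_iff numeral_3_eq_3)
  have longest: "longest_path (a # b # c # r)" "longest_path (a' # b' # c' # r')"
    using p(1) longest_path_rev [OF p(1)] abc abc' by simp_all
  have path: "E a b" "E b c" "a \<noteq> b" "b \<noteq> c" "a \<noteq> c"
    using longest(1) by (auto simp: longest_path_def is_path_def)
  have leaves: "neighbours E a = {b}" "neighbours E a' = {b'}"
    using longest by (simp_all only: longest_path_end)
  have nb: "{a, c} \<subseteq> neighbours E b"
    using path by (auto dest: sym)
  then have deg_b: "degree E b \<ge> 2"
    using path card_mono [OF _ nb] by simp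
  \<comment> \<open>Otherwise \<open>leaf_neighbours\<close> gives \<open>b'\<close> degree above 2
    as well, so each end of the path has a twin leaf.\<close>
  have "neighbours E b = {a, c}"
  proof (rule ccontr)
    assume "neighbours E b \<noteq> {a, c}"
    then have "{a, c} \<subset> neighbours E b" using nb by auto
    then obtain u where u: "E b u" "u \<noteq> a" "u \<noteq> c"
      unfolding neighbours_def by blast
    have "card {a, c} < degree E b"
      using \<open>{a, c} \<subset> neighbours E b\<close> by (intro psubset_card_mono) auto
    also have "\<dots> = degree E b'"
      using leaf_neighbours [OF leaves deg_b] .
    finally have "\<not> neighbours E b' \<subseteq> {a', c'}"
      using path card_mono [of "{a', c'}" "neighbours E b'"] by (auto simp: card_insert_if split: if_splits)
    then obtain u' where u': "E b' u'" "u' \<noteq> a'" "u' \<noteq> c'"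
      unfolding neighbours_def by blast
    note sibling = longest_path_sibling [OF longest(1) u]
    note sibling' = longest_path_sibling [OF longest(2) u']
    have ends: "set (a' # b' # c' # r') = set (a # b # c # r)"
      using abc abc' by (metis set_rev)
    \<comment> \<open>The two ends differ: \<open>a'\<close> is the last vertex of
      \<open>c # r\<close>, while \<open>a\<close> does not occur there.\<close>
    have "last p = a'"
      using abc' by (metis hd_rev list.sel(1))
    then have "a' = last (c # r)"
      using abc by simp
    then have "a \<noteq> a'"
      using longest(1) last_in_set [of "c # r"] by (auto simp: longest_path_def is_path_def)
    moreover have "a' \<in> set (a # b # c # r)"
      unfolding ends [symmetric] by simp
    then have "u \<noteq> a" "u \<noteq> a'" "u' \<noteq> a" "u' \<noteq> a'"
      using sibling(1) sibling'(1) unfolding ends by auto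
    \<comment> \<open>At the positions \<open>a\<close> and \<open>a'\<close> the two kernel vectors
      form an identity matrix, so this minor is 1 instead of 0.\<close>
    ultimately show False
      using kernel_proportional [OF twin_leaves_kernel [OF leaves(1) sibling(2)]
          twin_leaves_kernel [OF leaves(2) sibling'(2)], of a a'] by simp
  qed
  then have deg_b2: "degree E b = 2" using path by simp

  have "degree E c \<noteq> 0"
    using sym [OF \<open>E b c\<close>] by (auto simp: neighbours_def)
  \<comment> \<open>The vertices \<open>a, b, c\<close> have degrees 1, 2, \<open>D\<close> and
    closed 4-walk counts 2, \<open>D + 3\<close>, \<open>s + D * (D - 1)\<close>; the determinant
    then forces \<open>s = D + 1\<close>, of which \<open>b\<close> accounts for 2.\<close>
  have sum_c: "(\<Sum>y\<in>neighbours E c - {b}. degree E y) + 1 = degree E c"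
  proof -
    define D where "D = degree E c"
    define s where "s = (\<Sum>y\<in>neighbours E c. degree E y)"
    have "(complex_of_nat 2 - 1) * (of_nat (s + D * (D - 1)) - 2) = (of_nat D - 1) * (of_nat (D + 3) - 2)"
      using det [of a b c] path leaves \<open>neighbours E b = {a, c}\<close>
      by (simp add: closed_walks_2_eq_degree closed_walks_4_tree D_def s_def sum.distrib)
    moreover obtain k where "D = Suc k"
      using \<open>degree E c \<noteq> 0\<close> not0_implies_Suc unfolding D_def by blast
    ultimately have "complex_of_nat s = of_nat (D + 1)"
      by (simp add: algebra_simps)
    then have "s = D + 1"
      by (simp only: of_nat_eq_iff)
    moreover have "s = 2 + (\<Sum>y\<in>neighbours E c - {b}. degree E y)"
      unfolding s_def using sym [OF \<open>E b c\<close>] by (subst sum.remove [of _ b]) (auto simp: deg_b2)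
    ultimately show ?thesis by (simp add: D_def)
  qed
  \<comment> \<open>By \<open>sum_c\<close> the \<open>degree E c - 1\<close> neighbours other than
    \<open>b\<close> have positive degrees with total \<open>degree E c - 1\<close>, so each degree
    is 1.\<close>
  have leaf: "degree E y = 1" if "E c y" "y \<noteq> b" for y
  proof -
    have positive: "degree E w \<ge> 1" if "E c w" for w
      using sym [OF that] by (auto simp: Suc_le_eq card_gt_0_iff neighbours_def)
    then have "(\<Sum>w\<in>neighbours E c - {b} - {y}. 1) \<le> (\<Sum>w\<in>neighbours E c - {b} - {y}. degree E w)"
      by (intro sum_mono) auto
    moreover have "(\<Sum>w\<in>neighbours E c - {b}. degree E w) =
        degree E y + (\<Sum>w\<in>neighbours E c - {b} - {y}. degree E w)"
      using that by (intro sum.remove) auto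
    moreover have "card (neighbours E c - {b} - {y}) = degree E c - 2" "degree E c \<ge> 2"
      using that sym [OF \<open>E b c\<close>] card_mono [of "neighbours E c" "{b, y}"] by (auto simp: card_Diff_singleton)
    ultimately have "degree E y \<le> 1" using sum_c by simp
    then show ?thesis
      using positive [OF that(1)] by simp
  qed
  have "neighbours E c \<noteq> {b}"
  proof
    assume "neighbours E c = {b}"
    then have "{a, b, c} = UNIV"
      using leaves \<open>neighbours E b = {a, c}\<close>
      by (intro closed_set_eq_UNIV) (auto simp: neighbours_def)
    then have "CARD('v) = card {a, b, c}" by simp
    then show False using assms(3) path by simp
  qed
  then obtain e where e: "E c e" "e \<noteq> b"
    using sym [OF \<open>E b c\<close>] by (auto simp: neighbours_def)
  then have ne: "neighbours E e = {c}"
    using leaf [OF e] sym [OF e(1)] by (metis card_1_singletonE mem_neighbours singletonD)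
  \<comment> \<open>Now \<open>c\<close> is the neighbour of the leaf \<open>e\<close>, so it has
    the same degree as \<open>b\<close>.\<close>
  have "degree E c = 2"
    using leaf_neighbours [OF leaves(1) ne deg_b] deg_b2 by simp
  then have nc: "neighbours E c = {b, e}"
    using e sym [OF \<open>E b c\<close>] card_subset_eq [of "neighbours E c" "{b, e}"] by simp
  have distinct: "e \<noteq> a" "e \<noteq> c"
    using ne leaves path e irrefl by auto
  have UNIV: "{a, b, c, e} = UNIV"
    using leaves ne nc \<open>neighbours E b = {a, c}\<close>
    by (intro closed_set_eq_UNIV) (auto simp: neighbours_def)
  have adj: "E a v \<longleftrightarrow> v = b" "E b v \<longleftrightarrow> v = a \<or> v = c" "E c v \<longleftrightarrow> v = b \<or> v = e" "E e v \<longleftrightarrow> v = c" for v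
    using leaves ne nc \<open>neighbours E b = {a, c}\<close> by (auto simp: neighbours_def set_eq_iff)
  define f :: "'v \<Rightarrow> nat" where "f = (\<lambda>v. if v = a then 0 else if v = b then 1 else if v = c then 2 else 3)"
  have f: "f a = 0" "f b = 1" "f c = 2" "f e = 3"
    using path distinct e by (auto simp: f_def)
  have "bij_betw f {a, b, c, e} {..<4}"
    using path distinct e by (auto simp: bij_betw_def f)
  moreover have "\<forall>u\<in>{a, b, c, e}. \<forall>v\<in>{a, b, c, e}. E u v \<longleftrightarrow> path_adj (f u) (f v)"
    using path distinct e by (simp add: f adj path_adj_def)
  ultimately have "graph_isomorphic UNIV E {..<4::nat} path_adj"
    unfolding graph_isomorphic_def UNIV by blast
  then show False
    using assms(4) by simp
qed

end
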